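(* There exists an incomplete pairwise comparison matrix $\mathbf{A}$ of order $5$, with connected associated graph, such that the logarithmic least squares optimal completion of $\mathbf{A}$ and the eigenvalue optimal completion of $\mathbf{A}$ are different.
   Context: Let $\mathbb{R}_+$ denote the set of positive real numbers. An incomplete pairwise comparison matrix of order $n$ is an $n\times n$ array $\mathbf{A}=[a_{ij}]$ with entries $a_{ij}\in\mathbb{R}_+\cup\{\ast\}$ (where $\ast$ indicates a missing entry) such that for all $1\le i,j\le n$: $a_{ij}\in\mathbb{R}_+$ implies $a_{ji}=1/a_{ij}$, and $a_{ij}=\ast$ implies $a_{ji}=\ast$. Diagonal entries are known, so $a_{ii}=1$. The matrix is complete if it has no missing entries. Associated graph: the undirected graph $G=(V,E)$ with $V=\{1,\dots,n\}$ and, for $i\ne j$, $(i,j)\in E$ if and only if $a_{ij}\neq\ast$. Logarithmic least squares optimal completion: let $\mathbf{w}=[w_i]\in\mathbb{R}^n_+$ be an optimal solution of $$\min \sum_{i,j:\, a_{ij}\neq\ast}\left[\log a_{ij}-\log\left(\frac{w_i}{w_j}\right)\right]^2\quad\text{subject to } w_i>0 \text{ for all } i=1,\dots,n.$$ The logarithmic least squares optimal completion of $\mathbf{A}$ is the complete pairwise comparison matrix $\mathbf{B}=[b_{ij}]$ with $b_{ij}=a_{ij}$ if $a_{ij}\neq\ast$ and $b_{ij}=w_i/w_j$ if $a_{ij}=\ast$. Eigenvalue optimal completion: let $m$ be the number of missing comparisons (unordered pairs $\{i,j\}$ with $a_{ij}=\ast$). For $\mathbf{x}\in\mathbb{R}^m_+$,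 let $\mathbf{A}(\mathbf{x})$ be the complete pairwise comparison matrix obtained from $\mathbf{A}$ by replacing the missing entries $a_{ij}$ with $i<j$ by the coordinates of $\mathbf{x}$ and the missing entries $a_{ji}$ by the corresponding reciprocals. Let $\lambda_{\max}(\mathbf{A}(\mathbf{x}))$ denote the dominant (Perron) eigenvalue of this positive matrix. The eigenvalue optimal completion of $\mathbf{A}$ is $\mathbf{A}(\mathbf{x}^* )$, where $\mathbf{x}^*$ is the minimiser of $\lambda_{\max}(\mathbf{A}(\mathbf{x}))$ over $\mathbf{x}\in\mathbb{R}^m_+$. It is known (Bozóki, Fülöp, Rónyai, 2010) that both optimal completions exist and are unique if and only if $G$ is connected (with $\mathbf{w}$ unique up to multiplication by a positive scalar). *)

theory Defs
  imports
    Complex_Main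
    "HOL-Library.FuncSet"
    "Jordan_Normal_Form.Char_Poly"
    "Graph_Theory.Digraph_Component"
begin

text \<open>
  Entries are indexed from \<open>0\<close> to \<open>n - 1\<close>; \<^const>\<open>None\<close> marks a missing entry.
\<close>

definition incomplete_pcm :: "nat \<Rightarrow> real option mat \<Rightarrow> bool" where
  "incomplete_pcm n A \<longleftrightarrow>
     A \<in> carrier_mat n n \<and>
     (\<forall>i<n. \<forall>j<n. \<forall>a. A $$ (i, j) = Some a \<longrightarrow> a > 0 \<and> A $$ (j, i) = Some (1 / a)) \<and>
     (\<forall>i<n. \<forall>j<n. A $$ (i, j) = None \<longrightarrow> A $$ (j, i) = None) \<and>
     (\<forall>i<n. A $$ (i, i) = Some 1)"

text \<open>
  An undirected edge is represented by its two orientations.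
\<close>

definition comparison_graph :: "real option mat \<Rightarrow> nat pair_pre_digraph" where
  "comparison_graph A =
     \<lparr> pverts = {..<dim_row A},
       parcs = {(i, j). i < dim_row A \<and> j < dim_row A \<and> i \<noteq> j \<and> A $$ (i, j) \<noteq> None} \<rparr>"

definition lls_objective :: "real option mat \<Rightarrow> real vec \<Rightarrow> real" where
  "lls_objective A w =
     (\<Sum>(i, j) \<in> {(i, j). i < dim_row A \<and> j < dim_row A \<and> A $$ (i, j) \<noteq> None}.
        (ln (the (A $$ (i, j))) - ln (w $ i / w $ j))\<^sup>2)"

definition positive_vec :: "nat \<Rightarrow> real vec \<Rightarrow> bool" where
  "positive_vec n w \<longleftrightarrow> w \<in> carrier_vec n \<and> (\<forall>i<n. w $ i > 0)"

definition lls_optimal_completion :: "real option mat \<Rightarrow> real mat \<Rightarrow> bool" where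
  "lls_optimal_completion A B \<longleftrightarrow>
     (\<exists>w. is_arg_min (lls_objective A) (positive_vec (dim_row A)) w \<and>
          B = mat (dim_row A) (dim_row A)
                (\<lambda>(i, j). case A $$ (i, j) of Some a \<Rightarrow> a | None \<Rightarrow> w $ i / w $ j))"

text \<open>
  The coordinates of the parameter vector are indexed by the missing positions above the diagonal
  themselves, so that \<open>missing A \<rightarrow>\<^sub>E {0<..}\<close> stands for the positive vectors with \<open>m\<close> coordinates,
  where \<open>m = card (missing A)\<close>.
\<close>

definition missing :: "real option mat \<Rightarrow> (nat \<times> nat) set" where
  "missing A = {(i, j). i < j \<and> j < dim_row A \<and> A $$ (i, j) = None}"

definition complete_with :: "real option mat \<Rightarrow> (nat \<times> nat \<Rightarrow> real) \<Rightarrow> real mat" where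
  "complete_with A x =
     mat (dim_row A) (dim_row A)
       (\<lambda>(i, j). case A $$ (i, j) of
           Some a \<Rightarrow> a
         | None \<Rightarrow> if i < j then x (i, j) else 1 / x (j, i))"

text \<open>
  The real eigenvalue whose modulus is maximal among all complex eigenvalues. There is at most one
  such number for any matrix, and for a positive matrix it exists by Perron's theorem.
\<close>

definition dominant_eigenvalue :: "real mat \<Rightarrow> real" where
  "dominant_eigenvalue B =
     (THE r. eigenvalue (map_mat complex_of_real B) (complex_of_real r) \<and>
             (\<forall>\<mu>. eigenvalue (map_mat complex_of_real B) \<mu> \<longrightarrow> cmod \<mu> \<le> r))"

lemma dominant_eigenvalue_eqI:
  assumes "eigenvalue (map_mat complex_of_real B) (complex_of_real r)"
    and "\<And>\<mu>. eigenvalue (map_mat complex_of_real B) \<mu> \<Longrightarrow> cmod \<mu> \<le> r"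
  shows "dominant_eigenvalue B = r"
  unfolding dominant_eigenvalue_def
proof (rule the_equality)
  fix s
  assume s: "eigenvalue (map_mat complex_of_real B) (complex_of_real s) \<and>
    (\<forall>\<mu>. eigenvalue (map_mat complex_of_real B) \<mu> \<longrightarrow> cmod \<mu> \<le> s)"
  have "\<bar>s\<bar> \<le> r" using assms(2)[of "complex_of_real s"] s by simp
  moreover have "\<bar>r\<bar> \<le> s" using assms(1) s norm_of_real[of r, where 'a = complex] by metis
  ultimately show "s = r" by linarith
qed (use assms in blast)

definition eigenvalue_optimal_completion :: "real option mat \<Rightarrow> real mat \<Rightarrow> bool" where
  "eigenvalue_optimal_completion A B \<longleftrightarrow>
     (\<exists>x. is_arg_min (\<lambda>x. dominant_eigenvalue (complete_with A x))
                     (\<lambda>x. x \<in> missing A \<rightarrow>\<^sub>E {0<..}) x \<and>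
          B = complete_with A x)"

end

theory Submission
  imports Defs "Jordan_Normal_Form.Spectral_Radius"
begin

text \<open>
  The comparison graph of the example is two triangles sharing the vertex \<open>0\<close>. Least squares
  spreads the logarithmic residual of a triangle evenly over its three edges, whereas a completion
  is eigenvalue optimal when the flow \<open>v\<^sub>i b\<^sub>i\<^sub>j u\<^sub>j - v\<^sub>j b\<^sub>j\<^sub>i u\<^sub>i\<close>, formed with the right and left
  Perron vectors \<open>u\<close> and \<open>v\<close>, vanishes on the missing edges. The entries are chosen so that the
  second condition holds when all missing entries are \<open>1\<close>, with \<open>u\<close>, \<open>v\<close> and the eigenvalue \<open>6\<close>
  integral, while the evenly spread residuals force another value at position \<open>(1, 4)\<close>.
\<close>

section \<open>Perron's theorem for positive matrices\<close>

lemma mult_mat_vec_index_sum: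
  assumes "B \<in> carrier_mat n n" "z \<in> carrier_vec n" "i < n"
  shows "(B *\<^sub>v z) $ i = (\<Sum>j<n. B $$ (i, j) * z $ j)"
  using assms by (simp add: scalar_prod_def lessThan_atLeast0)

lemma smult_mat_mult_vec:
  fixes B :: "'a :: comm_ring_1 mat"
  assumes "B \<in> carrier_mat n m" "z \<in> carrier_vec m"
  shows "(c \<cdot>\<^sub>m B) *\<^sub>v z = c \<cdot>\<^sub>v (B *\<^sub>v z)"
  using assms by (intro eq_vecI) (auto simp: scalar_prod_def sum_distrib_left mult_ac)

text \<open>At an index \<open>k\<close> maximising \<open>cmod (x $ i) / z $ i\<close>, the
  triangle inequality in row \<open>k\<close> of the eigenvalue equation bounds
  \<open>cmod \<mu>\<close> by \<open>r\<close>.\<close>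

lemma dominant_eigenvalue_positive_eigenvector:
  fixes B :: "real mat"
  assumes B: "B \<in> carrier_mat n n" and n: "n > 0"
    and nonneg: "\<And>i j. i < n \<Longrightarrow> j < n \<Longrightarrow> B $$ (i, j) \<ge> 0"
    and z: "positive_vec n z" and ev: "B *\<^sub>v z = r \<cdot>\<^sub>v z"
  shows "dominant_eigenvalue B = r"
proof (rule dominant_eigenvalue_eqI)
  let ?C = "map_mat complex_of_real B"
  have zc: "z \<in> carrier_vec n" and zp: "\<And>i. i < n \<Longrightarrow> z $ i > 0"
    using z by (auto simp: positive_vec_def)
  have sumz: "(\<Sum>j<n. B $$ (i, j) * z $ j) = r * z $ i" if "i < n" for i
    using arg_cong[OF ev, of "\<lambda>v. v $ i"] that zc mult_mat_vec_index_sum[OF B zc that] by simp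
  show "eigenvalue ?C (complex_of_real r)"
    unfolding eigenvalue_def eigenvector_def
  proof (intro exI conjI)
    show "map_vec complex_of_real z \<in> carrier_vec (dim_row ?C)" using B zc by simp
    show "map_vec complex_of_real z \<noteq> 0\<^sub>v (dim_row ?C)"
    proof
      assume "map_vec complex_of_real z = 0\<^sub>v (dim_row ?C)"
      from arg_cong[OF this, of "\<lambda>v. v $ 0"] show False using zp[OF n] n zc B by simp
    qed
    have "?C *\<^sub>v map_vec complex_of_real z = map_vec complex_of_real (B *\<^sub>v z)"
      by (rule of_real_hom.mult_mat_vec_hom[OF B zc, symmetric])
    also have "\<dots> = complex_of_real r \<cdot>\<^sub>v map_vec complex_of_real z"
      unfolding ev by (simp add: of_real_hom.vec_hom_smult)
    finally show "?C *\<^sub>v map_vec complex_of_real z = complex_of_real r \<cdot>\<^sub>v map_vec complex_of_real z" .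
  qed
  fix \<mu> assume "eigenvalue ?C \<mu>"
  then obtain x where x: "x \<in> carrier_vec n" "x \<noteq> 0\<^sub>v n" "?C *\<^sub>v x = \<mu> \<cdot>\<^sub>v x"
    using B unfolding eigenvalue_def eigenvector_def by auto
  have C: "?C \<in> carrier_mat n n" using B by simp
  define q where "q i = cmod (x $ i) / z $ i" for i
  have "Max (q ` {..<n}) \<in> q ` {..<n}" using n by (intro Max_in) auto
  then obtain k where k: "k < n" "q k = Max (q ` {..<n})" by auto
  have qk: "q i \<le> q k" if "i < n" for i using that unfolding k(2) by simp
  have le: "cmod (x $ i) \<le> q k * z $ i" if "i < n" for i
    using qk[OF that] zp[OF that] by (simp add: q_def field_simps)
  obtain m where m: "m < n" "x $ m \<noteq> 0" using x(1,2) by (auto simp: vec_eq_iff)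
  have "q m > 0" using m zp by (simp add: q_def)
  then have pos: "q k > 0" using qk[OF m(1)] by linarith
  have "cmod \<mu> * (q k * z $ k) = cmod (\<mu> * x $ k)"
    using zp[OF k(1)] by (simp add: q_def norm_mult)
  also have "\<mu> * x $ k = (\<Sum>j<n. ?C $$ (k, j) * x $ j)"
    using arg_cong[OF x(3), of "\<lambda>v. v $ k"] k(1) x(1) mult_mat_vec_index_sum[OF C x(1) k(1)] by simp
  also have "cmod \<dots> \<le> (\<Sum>j<n. B $$ (k, j) * (q k * z $ j))"
  proof (rule sum_norm_le)
    fix j assume "j \<in> {..<n}"
    then show "cmod (?C $$ (k, j) * x $ j) \<le> B $$ (k, j) * (q k * z $ j)"
      using B k(1) le[of j] nonneg[of k j] by (auto simp: norm_mult intro!: mult_left_mono)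
  qed
  also have "\<dots> = q k * (\<Sum>j<n. B $$ (k, j) * z $ j)"
    by (simp add: sum_distrib_left mult_ac)
  also have "\<dots> = r * (q k * z $ k)" using sumz[OF k(1)] by simp
  finally show "cmod \<mu> \<le> r" using pos zp[OF k(1)] by simp
qed

text \<open>A nonnegative matrix preserves entrywise inequalities, so \<open>B *\<^sub>v z\<close>
  inherits the growth hypothesis from \<open>z\<close>. The induction therefore generalises over
  \<open>z\<close>.\<close>

lemma nonneg_mat_power_growth:
  fixes B :: "real mat"
  assumes B: "B \<in> carrier_mat n n" and z: "z \<in> carrier_vec n" and t: "t \<ge> 0"
    and nonneg: "\<And>i j. i < n \<Longrightarrow> j < n \<Longrightarrow> B $$ (i, j) \<ge> 0"
    and grow: "\<And>i. i < n \<Longrightarrow> (B *\<^sub>v z) $ i \<ge> t * z $ i"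
    and i: "i < n"
  shows "((B ^\<^sub>m k) *\<^sub>v z) $ i \<ge> t ^ k * z $ i"
  using z grow
proof (induction k arbitrary: z)
  case 0
  then show ?case using i B by simp
next
  case (Suc k)
  note z = Suc.prems(1) and grow = Suc.prems(2)
  have Bz: "B *\<^sub>v z \<in> carrier_vec n" using B z by simp
  have "(B *\<^sub>v (B *\<^sub>v z)) $ j \<ge> t * (B *\<^sub>v z) $ j" if j: "j < n" for j
  proof -
    have "t * (B *\<^sub>v z) $ j = (\<Sum>l<n. B $$ (j, l) * (t * z $ l))"
      using mult_mat_vec_index_sum[OF B z j] by (simp add: sum_distrib_left mult_ac)
    also have "\<dots> \<le> (\<Sum>l<n. B $$ (j, l) * (B *\<^sub>v z) $ l)"
      using grow nonneg j by (intro sum_mono mult_left_mono) auto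
    finally show ?thesis using mult_mat_vec_index_sum[OF B Bz j] by simp
  qed
  then have "t ^ k * (B *\<^sub>v z) $ i \<le> ((B ^\<^sub>m k) *\<^sub>v (B *\<^sub>v z)) $ i"
    using Suc.IH[OF Bz] by blast
  moreover have "t ^ k * (t * z $ i) \<le> t ^ k * (B *\<^sub>v z) $ i"
    using grow[OF i] t by (intro mult_left_mono) auto
  moreover have "(B ^\<^sub>m Suc k) *\<^sub>v z = (B ^\<^sub>m k) *\<^sub>v (B *\<^sub>v z)"
    using B z by (simp add: assoc_mult_mat_vec[of _ n n _ n])
  ultimately show ?case by (simp add: mult_ac)
qed

text \<open>This is the lower Collatz-Wielandt bound. Were the spectral radius below
  \<open>t\<close>, dividing \<open>B\<close> by some \<open>s\<close> strictly between the two
  would give bounded powers, although they stretch \<open>z\<close> by powers of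
  \<open>t / s > 1\<close>.\<close>

lemma spectral_radius_ge_growth:
  fixes B :: "real mat"
  assumes B: "B \<in> carrier_mat n n" and n: "n > 0" and z: "positive_vec n z"
    and nonneg: "\<And>i j. i < n \<Longrightarrow> j < n \<Longrightarrow> B $$ (i, j) \<ge> 0"
    and grow: "\<And>i. i < n \<Longrightarrow> (B *\<^sub>v z) $ i \<ge> t * z $ i"
  shows "spectral_radius (map_mat complex_of_real B) \<ge> t"
proof (rule ccontr)
  let ?C = "map_mat complex_of_real B"
  assume "\<not> ?thesis"
  then obtain s where s: "spectral_radius ?C < s" "s < t" using dense by (meson not_le)
  have C: "?C \<in> carrier_mat n n" using B by simp
  have zc: "z \<in> carrier_vec n" and zp: "\<And>i. i < n \<Longrightarrow> z $ i > 0"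
    using z by (auto simp: positive_vec_def)
  have "spectral_radius ?C \<ge> 0" using spectral_radius_mem_max(1)[OF C n] by auto
  then have s0: "s > 0" using s by linarith
  define D where "D = (1 / s) \<cdot>\<^sub>m B"
  have D: "D \<in> carrier_mat n n" using B by (simp add: D_def)
  let ?D = "map_mat complex_of_real D"
  have Dc: "?D \<in> carrier_mat n n" using D by simp
  obtain \<mu> where \<mu>: "eigenvalue ?D \<mu>" "spectral_radius ?D = cmod \<mu>"
    using spectral_radius_mem_max(1)[OF Dc n] by (auto simp: spectrum_def)
  then obtain x where x: "x \<in> carrier_vec n" "x \<noteq> 0\<^sub>v n" "?D *\<^sub>v x = \<mu> \<cdot>\<^sub>v x"
    using D unfolding eigenvalue_def eigenvector_def by auto
  \<comment> \<open>Multiplying an eigenvalue of \<open>D\<close> by \<open>s\<close> gives an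
    eigenvalue of \<open>B\<close>; this is what pushes the spectral radius of \<open>D\<close>
    below 1.\<close>
  have "?C = complex_of_real s \<cdot>\<^sub>m ?D" using s0 B by (auto simp: D_def)
  then have "?C *\<^sub>v x = (complex_of_real s * \<mu>) \<cdot>\<^sub>v x"
    using smult_mat_mult_vec[OF Dc x(1), of "complex_of_real s"] x(3)
    by (simp add: smult_smult_assoc)
  then have "eigenvalue ?C (complex_of_real s * \<mu>)"
    using x(1,2) B unfolding eigenvalue_def eigenvector_def by auto
  then have "s * cmod \<mu> \<le> spectral_radius ?C"
    using spectral_radius_mem_max(2)[OF C n imageI, of "complex_of_real s * \<mu>"] s0
    by (simp add: spectrum_def norm_mult)
  then have "spectral_radius ?D < 1" using s s0 \<mu>(2)
    by (smt (verit) mult_le_cancel_left1)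
  then obtain c where c: "\<And>k. norm_bound (?D ^\<^sub>m k) c"
    using spectral_radius_jnf_norm_bound_less_1_upper_triangular[OF Dc] by blast
  have Dpow: "D ^\<^sub>m k \<in> carrier_mat n n" for k using D by (rule pow_carrier_mat)
  \<comment> \<open>The contradiction is read off at coordinate 0, so only row 0 has to be
    bounded.\<close>
  have bound: "\<bar>(D ^\<^sub>m k) $$ (0, j)\<bar> \<le> c" if "j < n" for k j
  proof -
    have "?D ^\<^sub>m k = map_mat complex_of_real (D ^\<^sub>m k)"
      by (rule of_real_hom.mat_hom_pow[OF D, symmetric])
    then show ?thesis using c[of k] that n Dpow[of k] unfolding norm_bound_def by force
  qed
  have growD: "(D *\<^sub>v z) $ i \<ge> (t / s) * z $ i" if "i < n" for i
    using grow[OF that] s0 smult_mat_mult_vec[OF B zc, of "1 / s"] that B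
    by (simp add: D_def divide_right_mono)
  have le: "(t / s) ^ k * z $ 0 \<le> (\<Sum>j<n. c * z $ j)" for k
  proof -
    have "(t / s) ^ k * z $ 0 \<le> ((D ^\<^sub>m k) *\<^sub>v z) $ 0"
      using nonneg_mat_power_growth[OF D zc _ _ growD n] s s0 nonneg B by (simp add: D_def)
    also have "\<dots> = (\<Sum>j<n. (D ^\<^sub>m k) $$ (0, j) * z $ j)"
      by (rule mult_mat_vec_index_sum[OF Dpow zc n])
    also have "\<dots> \<le> (\<Sum>j<n. c * z $ j)"
    proof (intro sum_mono mult_right_mono)
      fix j assume "j \<in> {..<n}"
      then show "(D ^\<^sub>m k) $$ (0, j) \<le> c" "0 \<le> z $ j"
        using bound[of j k] zp[of j] by auto
    qed
    finally show ?thesis .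
  qed
  have "1 < t / s" using s s0 by simp
  then obtain k where "(\<Sum>j<n. c * z $ j) / z $ 0 < (t / s) ^ k"
    using real_arch_pow by blast
  then show False using le[of k] zp[OF n] by (simp add: field_simps)
qed

text \<open>For an eigenvalue of largest modulus, the entrywise moduli \<open>y\<close> of an
  eigenvector satisfy \<open>\<rho> * y $ i \<le> (B *\<^sub>v y) $ i\<close> by the triangle
  inequality. Strictness at one index would, after one more application of the positive matrix,
  become strictness at all of them and contradict the growth bound.\<close>

lemma perron_positive_eigenvector:
  fixes B :: "real mat"
  assumes B: "B \<in> carrier_mat n n" and n: "n > 0"
    and pos: "\<And>i j. i < n \<Longrightarrow> j < n \<Longrightarrow> B $$ (i, j) > 0"
  shows "\<exists>z. positive_vec n z \<and> B *\<^sub>v z = dominant_eigenvalue B \<cdot>\<^sub>v z"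
proof -
  let ?C = "map_mat complex_of_real B"
  have C: "?C \<in> carrier_mat n n" using B by simp
  define \<rho> where "\<rho> = spectral_radius ?C"
  obtain \<mu> where \<mu>: "eigenvalue ?C \<mu>" "\<rho> = cmod \<mu>"
    using spectral_radius_mem_max(1)[OF C n] by (auto simp: spectrum_def \<rho>_def)
  then obtain x where x: "x \<in> carrier_vec n" "x \<noteq> 0\<^sub>v n" "?C *\<^sub>v x = \<mu> \<cdot>\<^sub>v x"
    using B unfolding eigenvalue_def eigenvector_def by auto
  define y where "y = vec n (\<lambda>i. cmod (x $ i))"
  \<comment> \<open>At this stage \<open>y\<close> may have zero entries; its image \<open>z\<close>
    is strictly positive, as the growth bound demands.\<close>
  define z where "z = B *\<^sub>v y"
  have y: "y \<in> carrier_vec n" by (simp add: y_def)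
  have zc: "z \<in> carrier_vec n" using B y by (simp add: z_def)
  obtain m where m: "m < n" "x $ m \<noteq> 0" using x(1,2) by (auto simp: vec_eq_iff)
  have y0: "y $ i \<ge> 0" if "i < n" for i using that by (simp add: y_def)
  have ym: "y $ m > 0" using m by (simp add: y_def)
  have zi: "z $ i = (\<Sum>j<n. B $$ (i, j) * y $ j)" if "i < n" for i
    unfolding z_def by (rule mult_mat_vec_index_sum[OF B y that])
  have sum_pos': "(\<Sum>j<n. B $$ (i, j) * f j) > 0"
    if "i < n" "l < n" "f l > 0" "\<And>j. j < n \<Longrightarrow> f j \<ge> 0" for i l and f :: "nat \<Rightarrow> real"
  proof (rule sum_pos2)
    show "finite {..<n}" "l \<in> {..<n}" using that by auto
    show "0 < B $$ (i, l) * f l" using that pos by simp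
    show "0 \<le> B $$ (i, j) * f j" if "j \<in> {..<n}" for j
      using that \<open>i < n\<close> pos[of i j] \<open>\<And>j. j < n \<Longrightarrow> f j \<ge> 0\<close>[of j] by simp
  qed
  have zp: "z $ i > 0" if "i < n" for i
    using sum_pos'[of i m "($) y"] that m(1) ym y0 zi by simp
  have ge: "\<rho> * y $ i \<le> z $ i" if i: "i < n" for i
  proof -
    have "\<rho> * y $ i = cmod (\<mu> * x $ i)" using i by (simp add: y_def \<mu>(2) norm_mult)
    also have "\<mu> * x $ i = (\<Sum>j<n. ?C $$ (i, j) * x $ j)"
      using arg_cong[OF x(3), of "\<lambda>v. v $ i"] i x(1) mult_mat_vec_index_sum[OF C x(1) i] by simp
    also have "cmod \<dots> \<le> (\<Sum>j<n. B $$ (i, j) * y $ j)"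
    proof (rule sum_norm_le)
      fix j assume "j \<in> {..<n}"
      then show "cmod (?C $$ (i, j) * x $ j) \<le> B $$ (i, j) * y $ j"
        using B i pos[of i j] by (simp add: norm_mult y_def)
    qed
    finally show ?thesis using zi[OF i] by simp
  qed
  have eq: "z $ i = \<rho> * y $ i" if i: "i < n" for i
  proof (rule ccontr)
    assume "z $ i \<noteq> \<rho> * y $ i"
    then have gt: "z $ i - \<rho> * y $ i > 0" using ge[OF i] by simp
    have strict: "(B *\<^sub>v z) $ l > \<rho> * z $ l" if l: "l < n" for l
    proof -
      have "(\<Sum>j<n. B $$ (l, j) * (z $ j - \<rho> * y $ j)) > 0"
        using sum_pos'[of l i "\<lambda>j. z $ j - \<rho> * y $ j"] l i gt ge by simp
      also have "(\<Sum>j<n. B $$ (l, j) * (z $ j - \<rho> * y $ j)) = (B *\<^sub>v z) $ l - \<rho> * z $ l"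
        by (simp add: mult_mat_vec_index_sum[OF B zc l] zi[OF l] right_diff_distrib
            sum_subtractf sum_distrib_left mult_ac)
      finally show ?thesis by simp
    qed
    \<comment> \<open>The least quotient is a growth factor valid at every coordinate, and by
      \<open>strict\<close> it still exceeds \<open>\<rho>\<close>.\<close>
    define q where "q l = (B *\<^sub>v z) $ l / z $ l" for l
    have "Min (q ` {..<n}) \<in> q ` {..<n}" using n by (intro Min_in) auto
    then obtain k where k: "k < n" "q k = Min (q ` {..<n})" by auto
    have "q k * z $ l \<le> (B *\<^sub>v z) $ l" if "l < n" for l
    proof -
      have "q k \<le> q l" using that unfolding k(2) by simp
      then show ?thesis using pos_le_divide_eq[OF zp[OF that], of "q k"] unfolding q_def[of l] by blast
    qed
    then have "q k \<le> \<rho>"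
      unfolding \<rho>_def using spectral_radius_ge_growth[OF B n, of z "q k"] zc zp pos
      by (simp add: positive_vec_def less_imp_le)
    moreover have "q k > \<rho>" using strict[OF k(1)] zp[OF k(1)] by (simp add: q_def pos_less_divide_eq)
    ultimately show False by simp
  qed
  have "\<rho> \<ge> 0" by (simp add: \<mu>(2))
  then have "y $ i > 0" if "i < n" for i
    using eq[OF that] zp[OF that] y0[OF that] by (metis less_eq_real_def mult_zero_right)
  then have py: "positive_vec n y" using y by (simp add: positive_vec_def)
  have ev: "B *\<^sub>v y = \<rho> \<cdot>\<^sub>v y"
    using eq zc y B by (intro eq_vecI) (auto simp: z_def)
  have "dominant_eigenvalue B = \<rho>"
    using dominant_eigenvalue_positive_eigenvector[OF B n _ py ev] pos by (simp add: less_imp_le)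
  then show ?thesis using py ev by auto
qed

section \<open>Optimality of eigenvalue completions\<close>

lemma incomplete_pcmD:
  assumes "incomplete_pcm n A"
  shows "dim_row A = n"
    and "i < n \<Longrightarrow> A $$ (i, i) = Some 1"
    and "i < n \<Longrightarrow> j < n \<Longrightarrow> A $$ (i, j) = Some a \<Longrightarrow> a > 0"
    and "i < n \<Longrightarrow> j < n \<Longrightarrow> A $$ (i, j) = Some a \<Longrightarrow> A $$ (j, i) = Some (1 / a)"
    and "i < n \<Longrightarrow> j < n \<Longrightarrow> A $$ (i, j) = None \<Longrightarrow> A $$ (j, i) = None"
  using assms unfolding incomplete_pcm_def by blast+

text \<open>
  A Donsker--Varadhan type bound: with \<open>z\<close> the Perron vector of \<open>C\<close> and \<open>r = z / u\<close>, weight the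
  inequality \<open>ln \<theta> \<le> \<theta> - 1\<close> for \<open>\<theta> = C\<^sub>i\<^sub>j r\<^sub>j / (B\<^sub>i\<^sub>j r\<^sub>i)\<close> by \<open>v\<^sub>i B\<^sub>i\<^sub>j u\<^sub>j\<close>; the terms \<open>ln r\<close> cancel
  because these weights have equal row and column sums.
\<close>

lemma dominant_eigenvalue_variational:
  fixes B C :: "real mat" and u v :: "nat \<Rightarrow> real"
  assumes C: "C \<in> carrier_mat n n" and n: "n > 0"
    and posB: "\<And>i j. i < n \<Longrightarrow> j < n \<Longrightarrow> B $$ (i, j) > 0"
    and posC: "\<And>i j. i < n \<Longrightarrow> j < n \<Longrightarrow> C $$ (i, j) > 0"
    and u: "\<And>i. i < n \<Longrightarrow> u i > 0" and v: "\<And>i. i < n \<Longrightarrow> v i > 0"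
    and right: "\<And>i. i < n \<Longrightarrow> (\<Sum>j<n. B $$ (i, j) * u j) = \<rho> * u i"
    and left: "\<And>j. j < n \<Longrightarrow> (\<Sum>i<n. v i * B $$ (i, j)) = \<rho> * v j"
    and critical: "(\<Sum>i<n. \<Sum>j<n. v i * B $$ (i, j) * u j * ln (C $$ (i, j) / B $$ (i, j))) = 0"
  shows "\<rho> \<le> dominant_eigenvalue C"
    and "dominant_eigenvalue C = \<rho> \<Longrightarrow>
      \<exists>r. (\<forall>i<n. r i > 0) \<and> (\<forall>i<n. \<forall>j<n. C $$ (i, j) * r j = B $$ (i, j) * r i)"
proof -
  define \<mu> where "\<mu> = dominant_eigenvalue C"
  obtain z where z: "positive_vec n z" "C *\<^sub>v z = \<mu> \<cdot>\<^sub>v z"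
    using perron_positive_eigenvector[OF C n posC] unfolding \<mu>_def by blast
  have zc: "z \<in> carrier_vec n" and zp: "\<And>i. i < n \<Longrightarrow> z $ i > 0"
    using z(1) by (auto simp: positive_vec_def)
  have Cz: "(\<Sum>j<n. C $$ (i, j) * z $ j) = \<mu> * z $ i" if "i < n" for i
    using arg_cong[OF z(2), of "\<lambda>v. v $ i"] that zc mult_mat_vec_index_sum[OF C zc that] by simp
  define r where "r i = z $ i / u i" for i
  define p where "p i j = v i * B $$ (i, j) * u j" for i j
  define \<theta> where "\<theta> i j = C $$ (i, j) / B $$ (i, j) * (r j / r i)" for i j
  have rp: "r i > 0" if "i < n" for i using u zp that by (simp add: r_def)
  have pp: "p i j > 0" if "i < n" "j < n" for i j using u v posB that by (simp add: p_def)
  have \<theta>p: "\<theta> i j > 0" if "i < n" "j < n" for i j using rp posB posC that by (simp add: \<theta>_def)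
  have row: "(\<Sum>j<n. p i j) = \<rho> * (v i * u i)" if "i < n" for i
    using right[OF that] by (simp add: p_def mult.assoc flip: sum_distrib_left)
  have col: "(\<Sum>i<n. p i j) = \<rho> * (v j * u j)" if "j < n" for j
    using left[OF that] by (simp add: p_def flip: sum_distrib_right)
  have "(\<Sum>j<n. p i j * \<theta> i j) = \<mu> * (v i * u i)" if i: "i < n" for i
  proof -
    \<comment> \<open>The entry of \<open>B\<close> cancels and \<open>u j * r j\<close> is
      \<open>z $ j\<close>, which leaves the eigenvalue equation of \<open>C\<close>.\<close>
    have "p i j * \<theta> i j = v i / r i * (C $$ (i, j) * z $ j)" if "j < n" for j
      using posB[OF i that] u[OF that] by (simp add: p_def \<theta>_def r_def)
    then have "(\<Sum>j<n. p i j * \<theta> i j) = (\<Sum>j<n. v i / r i * (C $$ (i, j) * z $ j))"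
      by (intro sum.cong) auto
    also have "\<dots> = v i / r i * (\<mu> * z $ i)"
      by (simp only: Cz[OF i] flip: sum_distrib_left)
    also have "\<dots> = \<mu> * (v i * u i)" using zp[OF i] u[OF i] by (simp add: r_def)
    finally show ?thesis .
  qed
  then have total: "(\<Sum>i<n. \<Sum>j<n. p i j * \<theta> i j) = \<mu> * (\<Sum>i<n. v i * u i)"
    by (simp add: sum_distrib_left)
  have weights: "(\<Sum>i<n. \<Sum>j<n. p i j) = \<rho> * (\<Sum>i<n. v i * u i)"
    using row by (simp add: sum_distrib_left)
  have "(\<Sum>i<n. \<Sum>j<n. p i j * ln (\<theta> i j)) =
      (\<Sum>i<n. \<Sum>j<n. p i j * ln (C $$ (i, j) / B $$ (i, j)) + p i j * ln (r j) - p i j * ln (r i))"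
  proof (intro sum.cong refl)
    fix i j assume "i \<in> {..<n}" "j \<in> {..<n}"
    then show "p i j * ln (\<theta> i j) =
        p i j * ln (C $$ (i, j) / B $$ (i, j)) + p i j * ln (r j) - p i j * ln (r i)"
      using rp[of i] rp[of j] posB[of i j] posC[of i j]
      by (simp add: \<theta>_def ln_mult_pos ln_div algebra_simps)
  qed
  also have "\<dots> = (\<Sum>i<n. \<Sum>j<n. p i j * ln (C $$ (i, j) / B $$ (i, j))) +
      (\<Sum>i<n. \<Sum>j<n. p i j * ln (r j)) - (\<Sum>i<n. \<Sum>j<n. p i j * ln (r i))"
    by (simp add: sum.distrib sum_subtractf)
  also have "(\<Sum>i<n. \<Sum>j<n. p i j * ln (r j)) = (\<Sum>j<n. (\<Sum>i<n. p i j) * ln (r j))"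
    by (subst sum.swap) (simp add: sum_distrib_right)
  also have "\<dots> = (\<Sum>i<n. (\<Sum>j<n. p i j) * ln (r i))"
    using row col by simp
  also have "\<dots> = (\<Sum>i<n. \<Sum>j<n. p i j * ln (r i))" by (simp add: sum_distrib_right)
  finally have logs: "(\<Sum>i<n. \<Sum>j<n. p i j * ln (\<theta> i j)) = 0"
    using critical by (simp add: p_def)
  \<comment> \<open>The weighted slack of \<open>ln \<theta> \<le> \<theta> - 1\<close>. Its total
    is the eigenvalue gap times a positive number, which yields both the bound and the equality
    case.\<close>
  define g where "g i j = p i j * (\<theta> i j - 1 - ln (\<theta> i j))" for i j
  have g0: "g i j \<ge> 0" if "i < n" "j < n" for i j
    using pp[OF that] ln_le_minus_one[OF \<theta>p[OF that]] by (simp add: g_def)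
  have gap: "(\<Sum>i<n. \<Sum>j<n. g i j) = (\<mu> - \<rho>) * (\<Sum>i<n. v i * u i)"
    using total weights logs by (simp add: g_def right_diff_distrib sum_subtractf left_diff_distrib)
  have vu: "(\<Sum>i<n. v i * u i) > 0"
    using n u v by (intro sum_pos) auto
  have "(\<Sum>i<n. \<Sum>j<n. g i j) \<ge> 0" using g0 by (intro sum_nonneg) auto
  then show "\<rho> \<le> dominant_eigenvalue C"
    using gap vu by (simp add: \<mu>_def zero_le_mult_iff)
  assume "dominant_eigenvalue C = \<rho>"
  then have "(\<Sum>i<n. \<Sum>j<n. g i j) = 0" using gap by (simp add: \<mu>_def)
  then have gz: "g i j = 0" if "i < n" "j < n" for i j
  proof -
    have "(\<Sum>j<n. g i j) = 0"
    proof (rule sum_nonneg_0[OF _ _ \<open>(\<Sum>i<n. \<Sum>j<n. g i j) = 0\<close>])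
      show "0 \<le> (\<Sum>j<n. g i j)" if "i \<in> {..<n}" for i
        using that g0 by (intro sum_nonneg) auto
    qed (use that in auto)
    then show ?thesis
      using sum_nonneg_0[of "{..<n}" "g i" j] g0 that by simp
  qed
  \<comment> \<open>Zero slack forces every \<open>\<theta> i j\<close> to be 1, so \<open>C\<close>
    arises from \<open>B\<close> by a diagonal similarity.\<close>
  have "C $$ (i, j) * r j = B $$ (i, j) * r i" if "i < n" "j < n" for i j
  proof -
    have "ln (\<theta> i j) = \<theta> i j - 1" using gz[OF that] pp[OF that] by (simp add: g_def)
    then have "\<theta> i j = 1" using \<theta>p[OF that] ln_eq_minus_one by blast
    then show ?thesis using posB[OF that] rp[OF that(1)] by (simp add: \<theta>_def field_simps)
  qed
  then show "\<exists>r. (\<forall>i<n. r i > 0) \<and> (\<forall>i<n. \<forall>j<n. C $$ (i, j) * r j = B $$ (i, j) * r i)"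
    using rp by blast
qed

lemma complete_with_pcm:
  assumes A: "incomplete_pcm n A" and x: "x \<in> missing A \<rightarrow>\<^sub>E {0<..}"
  shows "complete_with A x \<in> carrier_mat n n"
    and "i < n \<Longrightarrow> j < n \<Longrightarrow> complete_with A x $$ (i, j) > 0"
    and "i < n \<Longrightarrow> j < n \<Longrightarrow> complete_with A x $$ (j, i) = 1 / complete_with A x $$ (i, j)"
    and "i < n \<Longrightarrow> j < n \<Longrightarrow> A $$ (i, j) = Some a \<Longrightarrow> complete_with A x $$ (i, j) = a"
proof -
  have n: "dim_row A = n" by (rule incomplete_pcmD(1)[OF A])
  show "complete_with A x \<in> carrier_mat n n" by (simp add: complete_with_def n)
  show "complete_with A x $$ (i, j) = a" if "i < n" "j < n" "A $$ (i, j) = Some a"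
    using that by (simp add: complete_with_def n)
  assume ij: "i < n" "j < n"
  have "complete_with A x $$ (i, j) > 0 \<and>
    complete_with A x $$ (j, i) = 1 / complete_with A x $$ (i, j)"
  proof (cases "A $$ (i, j)")
    case (Some a)
    then have "a > 0" "A $$ (j, i) = Some (1 / a)" using incomplete_pcmD[OF A] ij by blast+
    then show ?thesis using Some ij by (simp add: complete_with_def n)
  next
    case None
    then have ji: "A $$ (j, i) = None" by (rule incomplete_pcmD(5)[OF A ij])
    have "i \<noteq> j" using incomplete_pcmD(2)[OF A ij(1)] None by auto
    with ji consider "i < j" "(i, j) \<in> missing A" | "j < i" "(j, i) \<in> missing A"
      using None ij n by (cases i j rule: linorder_cases) (auto simp: missing_def)
    then show ?thesis
    proof cases
      case 1
      then have "x (i, j) > 0" using x by auto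
      then show ?thesis using None ji ij 1 by (simp add: complete_with_def n)
    next
      case 2
      then have "x (j, i) > 0" using x by auto
      then show ?thesis using None ji ij 2 by (simp add: complete_with_def n)
    qed
  qed
  then show "complete_with A x $$ (i, j) > 0"
    "complete_with A x $$ (j, i) = 1 / complete_with A x $$ (i, j)" by auto
qed

text \<open>\<open>critical\<close> is the first-order condition in the logarithms of the missing
  entries; the variational bound turns it into global optimality. The hub \<open>k\<close>, compared
  with every index, yields uniqueness.\<close>

lemma eigenvalue_optimal_completion_iff:
  fixes u v :: "nat \<Rightarrow> real"
  assumes A: "incomplete_pcm n A" and x: "x \<in> missing A \<rightarrow>\<^sub>E {0<..}"
    and hub: "k < n" "\<And>i. i < n \<Longrightarrow> A $$ (k, i) \<noteq> None"
    and u: "\<And>i. i < n \<Longrightarrow> u i > 0" and v: "\<And>i. i < n \<Longrightarrow> v i > 0"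
    and right: "\<And>i. i < n \<Longrightarrow> (\<Sum>j<n. complete_with A x $$ (i, j) * u j) = \<rho> * u i"
    and left: "\<And>j. j < n \<Longrightarrow> (\<Sum>i<n. v i * complete_with A x $$ (i, j)) = \<rho> * v j"
    and critical: "\<And>i j. i < n \<Longrightarrow> j < n \<Longrightarrow> A $$ (i, j) = None \<Longrightarrow>
      v i * complete_with A x $$ (i, j) * u j = v j * complete_with A x $$ (j, i) * u i"
  shows "eigenvalue_optimal_completion A C \<longleftrightarrow> C = complete_with A x"
proof -
  define B where "B = complete_with A x"
  note right = right[folded B_def] and left = left[folded B_def]
    and critical = critical[folded B_def]
  have n: "n > 0" using hub(1) by simp
  have B: "B \<in> carrier_mat n n" and posB: "\<And>i j. i < n \<Longrightarrow> j < n \<Longrightarrow> B $$ (i, j) > 0"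
    and recB: "\<And>i j. i < n \<Longrightarrow> j < n \<Longrightarrow> B $$ (j, i) = 1 / B $$ (i, j)"
    using complete_with_pcm[OF A x] unfolding B_def by blast+
  have bound: "\<rho> \<le> dominant_eigenvalue D \<and> (dominant_eigenvalue D = \<rho> \<longrightarrow> D = B)"
    if y: "y \<in> missing A \<rightarrow>\<^sub>E {0<..}" and D_def: "D = complete_with A y" for y D
  proof -
    have D: "D \<in> carrier_mat n n" and posD: "\<And>i j. i < n \<Longrightarrow> j < n \<Longrightarrow> D $$ (i, j) > 0"
      and recD: "\<And>i j. i < n \<Longrightarrow> j < n \<Longrightarrow> D $$ (j, i) = 1 / D $$ (i, j)"
      using complete_with_pcm[OF A y] unfolding D_def by blast+
    have known: "D $$ (i, j) = B $$ (i, j)" if "i < n" "j < n" "A $$ (i, j) \<noteq> None" for i j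
      using complete_with_pcm(4)[OF A x] complete_with_pcm(4)[OF A y] that
      unfolding B_def D_def by fastforce
    define T where "T i j = v i * B $$ (i, j) * u j * ln (D $$ (i, j) / B $$ (i, j))" for i j
    \<comment> \<open>At missing positions the weight is symmetric by \<open>critical\<close> while
      the logarithm changes sign under transposition; at known positions the logarithm is 0.\<close>
    have anti: "T i j = - T j i" if ij: "i < n" "j < n" for i j
    proof (cases "A $$ (i, j) = None")
      case True
      have "ln (D $$ (j, i) / B $$ (j, i)) = - ln (D $$ (i, j) / B $$ (i, j))"
        using posB[OF ij] posD[OF ij] by (simp add: recB[OF ij] recD[OF ij] ln_div)
      then show ?thesis using critical[OF ij True] by (simp add: T_def)
    next
      case False
      moreover have "A $$ (j, i) \<noteq> None" using incomplete_pcmD(5)[OF A ij(2,1)] False by blast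
      ultimately show ?thesis using known ij posB[OF ij] posB[OF ij(2,1)] by (simp add: T_def)
    qed
    have "(\<Sum>i<n. \<Sum>j<n. T i j) = (\<Sum>i<n. \<Sum>j<n. - T j i)"
      by (intro sum.cong refl anti) auto
    also have "\<dots> = - (\<Sum>i<n. \<Sum>j<n. T i j)"
      by (subst sum.swap) (simp add: sum_negf)
    finally have crit: "(\<Sum>i<n. \<Sum>j<n. v i * B $$ (i, j) * u j * ln (D $$ (i, j) / B $$ (i, j))) = 0"
      by (simp add: T_def)
    have "D = B" if eq: "dominant_eigenvalue D = \<rho>"
    proof -
      obtain r where r: "\<And>i. i < n \<Longrightarrow> r i > 0"
          "\<And>i j. i < n \<Longrightarrow> j < n \<Longrightarrow> D $$ (i, j) * r j = B $$ (i, j) * r i"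
        using dominant_eigenvalue_variational(2)[OF D n posB posD u v right left crit eq] by auto
      \<comment> \<open>\<open>D\<close> and \<open>B\<close> agree on the known row
        \<open>k\<close>, so the diagonal similarity is by a constant.\<close>
      have rk: "r j = r k" if j: "j < n" for j
        using r(2)[OF hub(1) j] known[OF hub(1) j hub(2)[OF j]] posB[OF hub(1) j] by simp
      show ?thesis
      proof (rule eq_matI)
        fix i j assume "i < dim_row B" "j < dim_col B"
        then have ij: "i < n" "j < n" using B by auto
        show "D $$ (i, j) = B $$ (i, j)"
          using r(2)[OF ij] r(1)[OF hub(1)] rk[OF ij(1)] rk[OF ij(2)] by simp
      qed (use B D in auto)
    qed
    then show ?thesis using dominant_eigenvalue_variational(1)[OF D n posB posD u v right left crit] by blast
  qed
  \<comment> \<open>\<open>B\<close> attains the lower bound, hence so does every minimiser, which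
    then equals \<open>B\<close>.\<close>
  have "dominant_eigenvalue B = \<rho>"
  proof (rule dominant_eigenvalue_positive_eigenvector[OF B n])
    show "positive_vec n (vec n u)" using u by (simp add: positive_vec_def)
    show "B *\<^sub>v vec n u = \<rho> \<cdot>\<^sub>v vec n u"
    proof (rule eq_vecI)
      fix i assume "i < dim_vec (\<rho> \<cdot>\<^sub>v vec n u)"
      then have i: "i < n" by simp
      show "(B *\<^sub>v vec n u) $ i = (\<rho> \<cdot>\<^sub>v vec n u) $ i"
        using right[OF i] i mult_mat_vec_index_sum[OF B _ i, of "vec n u"] by simp
    qed (use B in auto)
  qed (use posB in \<open>simp add: less_imp_le\<close>)
  then show ?thesis
    using bound x unfolding eigenvalue_optimal_completion_def is_arg_min_def B_def
    by (metis (no_types, lifting) leD le_less)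
qed

section \<open>Optimality of logarithmic least squares completions\<close>

text \<open>
  The cross terms vanish because the residuals of \<open>w\<close> are antisymmetric, so that their column
  sums vanish along with their row sums.
\<close>

lemma lls_objective_shift:
  assumes A: "incomplete_pcm n A" and w: "positive_vec n w" and w': "positive_vec n w'"
    and residual: "\<And>i. i < n \<Longrightarrow>
      (\<Sum>j | j < n \<and> A $$ (i, j) \<noteq> None. ln (the (A $$ (i, j))) - ln (w $ i / w $ j)) = 0"
  defines "h \<equiv> \<lambda>i. ln (w' $ i) - ln (w $ i)"
  shows "lls_objective A w' = lls_objective A w +
    (\<Sum>(i, j) \<in> {(i, j). i < n \<and> j < n \<and> A $$ (i, j) \<noteq> None}. (h i - h j)\<^sup>2)"
proof -
  define K where "K = {(i, j). i < n \<and> j < n \<and> A $$ (i, j) \<noteq> None}"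
  define e where "e i j = ln (the (A $$ (i, j))) - ln (w $ i / w $ j)" for i j
  have n: "dim_row A = n" by (rule incomplete_pcmD(1)[OF A])
  have wp: "w $ i > 0" "w' $ i > 0" if "i < n" for i
    using w w' that by (auto simp: positive_vec_def)
  have K: "K = Sigma {..<n} (\<lambda>i. {j. j < n \<and> A $$ (i, j) \<noteq> None})" by (auto simp: K_def)
  have symK: "(j, i) \<in> K" if "(i, j) \<in> K" for i j
    using that incomplete_pcmD(5)[OF A, of j i] unfolding K_def mem_Collect_eq case_prod_conv by metis
  have swap: "(\<Sum>(i, j)\<in>K. f i j) = (\<Sum>(i, j)\<in>K. f j i)" for f :: "nat \<Rightarrow> nat \<Rightarrow> real"
    by (rule sum.reindex_bij_witness[of _ prod.swap prod.swap]) (use symK in auto)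
  have anti: "e j i = - e i j" if ij: "(i, j) \<in> K" for i j
  proof -
    obtain a where a: "A $$ (i, j) = Some a" "i < n" "j < n" using ij by (auto simp: K_def)
    then have "a > 0" "A $$ (j, i) = Some (1 / a)" using incomplete_pcmD[OF A] by blast+
    then show ?thesis using a wp(1)[of i] wp(1)[of j] by (simp add: e_def ln_div)
  qed
  have rows: "(\<Sum>(i, j)\<in>K. e i j * h i) = 0"
  proof -
    have "(\<Sum>(i, j)\<in>K. e i j * h i) =
        (\<Sum>i<n. (\<Sum>j | j < n \<and> A $$ (i, j) \<noteq> None. e i j) * h i)"
      unfolding K by (simp add: sum.Sigma sum_distrib_right)
    also have "\<dots> = 0" using residual by (simp add: e_def)
    finally show ?thesis .
  qed
  have "(\<Sum>(i, j)\<in>K. e i j * h j) = (\<Sum>(i, j)\<in>K. e j i * h i)" by (rule swap)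
  also have "\<dots> = (\<Sum>(i, j)\<in>K. - (e i j * h i))"
    by (rule sum.cong[OF refl], clarify) (subst anti, auto)
  finally have cols: "(\<Sum>(i, j)\<in>K. e i j * h j) = 0"
    using rows by (simp add: sum_negf case_prod_unfold)
  \<comment> \<open>Each residual of \<open>w'\<close> is \<open>e i j - (h i - h j)\<close>;
    squaring isolates the cross terms.\<close>
  have "lls_objective A w' =
      (\<Sum>(i, j)\<in>K. (e i j)\<^sup>2 - 2 * (e i j * h i) + 2 * (e i j * h j) + (h i - h j)\<^sup>2)"
    unfolding lls_objective_def n K_def[symmetric]
  proof (rule sum.cong[OF refl], clarify)
    fix i j assume "(i, j) \<in> K"
    then have "i < n" "j < n" by (auto simp: K_def)
    then have shift: "ln (the (A $$ (i, j))) - ln (w' $ i / w' $ j) = e i j - (h i - h j)"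
      using wp[of i] wp[of j] by (simp add: e_def h_def ln_div)
    show "(ln (the (A $$ (i, j))) - ln (w' $ i / w' $ j))\<^sup>2 =
        (e i j)\<^sup>2 - 2 * (e i j * h i) + 2 * (e i j * h j) + (h i - h j)\<^sup>2"
      unfolding shift by (simp add: power2_eq_square algebra_simps)
  qed
  also have "\<dots> = (\<Sum>(i, j)\<in>K. (e i j)\<^sup>2) - 2 * (\<Sum>(i, j)\<in>K. e i j * h i) +
      2 * (\<Sum>(i, j)\<in>K. e i j * h j) + (\<Sum>(i, j)\<in>K. (h i - h j)\<^sup>2)"
    by (simp add: sum.distrib sum_subtractf sum_distrib_left case_prod_unfold)
  finally show ?thesis
    using rows cols by (simp add: lls_objective_def n K_def e_def)
qed

text \<open>\<open>residual\<close> states the normal equations. By the shift identity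
  \<open>w\<close> is a minimiser, and any other minimiser has the same \<open>h\<close> at both
  ends of a known pair. Since the hub meets every index, it is a multiple of \<open>w\<close>, and
  the completion sees only ratios.\<close>

lemma lls_optimal_completion_iff:
  assumes A: "incomplete_pcm n A" and w: "positive_vec n w"
    and hub: "k < n" "\<And>i. i < n \<Longrightarrow> A $$ (k, i) \<noteq> None"
    and residual: "\<And>i. i < n \<Longrightarrow>
      (\<Sum>j | j < n \<and> A $$ (i, j) \<noteq> None. ln (the (A $$ (i, j))) - ln (w $ i / w $ j)) = 0"
  shows "lls_optimal_completion A B \<longleftrightarrow>
    B = mat n n (\<lambda>(i, j). case A $$ (i, j) of Some a \<Rightarrow> a | None \<Rightarrow> w $ i / w $ j)"
    (is "_ \<longleftrightarrow> B = ?M w")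
proof -
  define K where "K = {(i, j). i < n \<and> j < n \<and> A $$ (i, j) \<noteq> None}"
  have n: "dim_row A = n" by (rule incomplete_pcmD(1)[OF A])
  have finK: "finite K" by (rule finite_subset[of _ "{..<n} \<times> {..<n}"]) (auto simp: K_def)
  have ge: "lls_objective A w \<le> lls_objective A w'" if "positive_vec n w'" for w'
    using lls_objective_shift[OF A w that residual]
    by (simp add: sum_nonneg case_prod_unfold)
  have "?M w' = ?M w" if w': "positive_vec n w'" and "lls_objective A w' \<le> lls_objective A w" for w'
  proof -
    define h where "h i = ln (w' $ i) - ln (w $ i)" for i
    have "(\<Sum>(i, j)\<in>K. (h i - h j)\<^sup>2) = 0"
      using lls_objective_shift[OF A w w' residual] that(2) sum_nonneg[of K "\<lambda>(i, j). (h i - h j)\<^sup>2"]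
      by (fastforce simp: h_def K_def)
    then have "h i = h j" if "(i, j) \<in> K" for i j
      using that finK sum_nonneg_eq_0_iff[of K "\<lambda>(i, j). (h i - h j)\<^sup>2"] by fastforce
    then have hk: "h i = h k" if "i < n" for i
      using that hub by (force simp: K_def)
    have "w' $ i / w' $ j = w $ i / w $ j" if ij: "i < n" "j < n" for i j
    proof -
      have pos: "w $ i > 0" "w $ j > 0" "w' $ i > 0" "w' $ j > 0"
        using w w' ij by (auto simp: positive_vec_def)
      have "ln (w' $ i / w' $ j) = ln (w $ i / w $ j)"
        using hk[OF ij(1)] hk[OF ij(2)] pos by (simp add: h_def ln_div)
      then show ?thesis using pos by (subst (asm) ln_inj_iff) auto
    qed
    then show ?thesis by (intro cong_mat) (auto split: option.split)
  qed
  then show ?thesis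
    unfolding lls_optimal_completion_def n is_arg_min_def using w ge by (meson not_le)
qed

section \<open>An incomplete matrix whose graph is two triangles sharing a vertex\<close>

text \<open>Any two vertices are joined through the hub. Connectedness means strong connectedness of
  the symmetric closure, which is the graph \<open>G\<close> below.\<close>

lemma connected_comparison_graph:
  assumes A: "incomplete_pcm n A" and hub: "k < n" "\<And>i. i < n \<Longrightarrow> A $$ (k, i) \<noteq> None"
  shows "Digraph_Component.connected (with_proj (comparison_graph A))"
proof -
  define G where "G = with_proj (mk_symmetric (with_proj (comparison_graph A)))"
  note n = incomplete_pcmD(1)[OF A]
  have verts: "verts G = {..<n}"
    by (simp add: G_def mk_symmetric_def comparison_graph_def n)
  interpret wf_digraph G
    by unfold_locales (auto simp: G_def mk_symmetric_def comparison_graph_def n)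
  have "k \<rightarrow>\<^sup>*\<^bsub>G\<^esub> i \<and> i \<rightarrow>\<^sup>*\<^bsub>G\<^esub> k" if i: "i < n" for i
  proof (cases "i = k")
    case True
    then show ?thesis using hub(1) verts by auto
  next
    case False
    then have "(k, i) \<in> parcs (comparison_graph A)"
      using hub i by (simp add: comparison_graph_def n)
    then have "(k, i) \<in> arcs_ends G" "(i, k) \<in> arcs_ends G"
      by (auto simp: G_def mk_symmetric_def intro!: bexI[of _ "(k, i)"])
    then show ?thesis using reachable_adjI by blast
  qed
  then have "\<forall>i\<in>verts G. \<forall>j\<in>verts G. i \<rightarrow>\<^sup>*\<^bsub>G\<^esub> j"
    unfolding verts using reachable_trans by blast
  then show ?thesis
    using hub(1) verts unfolding connected_def strongly_connected_def G_def[symmetric] by auto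
qed

text \<open>The triangles on 0, 1, 2 and on 0, 3, 4 carry the same entries. Exchanging 1 with 3 and
  2 with 4 is thus a symmetry, and three parameters suffice.\<close>

definition bowtie_pcm :: "real \<Rightarrow> real \<Rightarrow> real \<Rightarrow> real option mat" where
  "bowtie_pcm \<alpha> \<beta> \<gamma> = mat 5 5 (\<lambda>(i, j).
     [[Some 1, Some \<alpha>, Some \<beta>, Some \<alpha>, Some \<beta>],
      [Some (1 / \<alpha>), Some 1, Some \<gamma>, None, None],
      [Some (1 / \<beta>), Some (1 / \<gamma>), Some 1, None, None],
      [Some (1 / \<alpha>), None, None, Some 1, Some \<gamma>],
      [Some (1 / \<beta>), None, None, Some (1 / \<gamma>), Some 1]] ! i ! j)"

lemma all_less_5: "(\<forall>i<5. P i) \<longleftrightarrow> P 0 \<and> P 1 \<and> P 2 \<and> P 3 \<and> P (4 :: nat)"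
  by (auto simp: numeral_eq_Suc less_Suc_eq)

lemma lessThan_5: "{..<5} = {0, 1, 2, 3, 4 :: nat}"
  by auto

lemma incomplete_pcm_bowtie:
  assumes "\<alpha> > 0" "\<beta> > 0" "\<gamma> > 0"
  shows "incomplete_pcm 5 (bowtie_pcm \<alpha> \<beta> \<gamma>)"
  using assms unfolding incomplete_pcm_def all_less_5
  by (simp add: bowtie_pcm_def)

lemma bowtie_pcm_hub: "i < 5 \<Longrightarrow> bowtie_pcm \<alpha> \<beta> \<gamma> $$ (0, i) \<noteq> None"
proof -
  have "\<forall>i<5. bowtie_pcm \<alpha> \<beta> \<gamma> $$ (0, i) \<noteq> None"
    unfolding all_less_5 by (simp add: bowtie_pcm_def)
  then show "i < 5 \<Longrightarrow> bowtie_pcm \<alpha> \<beta> \<gamma> $$ (0, i) \<noteq> None" by blast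
qed

text \<open>Around the cycle 0, 1, 2 the residuals add up to
  \<open>ln \<alpha> + ln \<gamma> - ln \<beta>\<close> for all weights. Equal shares cancel at each
  vertex, which solves the normal equations.\<close>

lemma lls_optimal_completion_bowtie:
  assumes pos: "\<alpha> > 0" "\<beta> > 0" "\<gamma> > 0"
  shows "\<exists>B. lls_optimal_completion (bowtie_pcm \<alpha> \<beta> \<gamma>) B"
    and "lls_optimal_completion (bowtie_pcm \<alpha> \<beta> \<gamma>) B \<Longrightarrow>
      ln (B $$ (1, 4)) = (2 * ln \<gamma> + ln \<beta> - ln \<alpha>) / 3"
proof -
  let ?A = "bowtie_pcm \<alpha> \<beta> \<gamma>"
  \<comment> \<open>the common residual of the edges of each triangle\<close>
  define e where "e = (ln \<alpha> + ln \<gamma> - ln \<beta>) / 3"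
  \<comment> \<open>With weight 1 at the hub, these values give residual \<open>e\<close> at (0, 1)
    and \<open>- e\<close> at (0, 2).\<close>
  define w1 where "w1 = exp (e - ln \<alpha>)"
  define w2 where "w2 = exp (- e - ln \<beta>)"
  define w where "w = vec 5 (\<lambda>i. [1, w1, w2, w1, w2] ! i)"
  have w: "w $ 0 = 1" "w $ Suc 0 = w1" "w $ 2 = w2" "w $ 3 = w1" "w $ 4 = w2" "dim_vec w = 5"
    by (simp_all add: w_def)
  have wp: "w1 > 0" "w2 > 0" by (simp_all add: w1_def w2_def)
  have nonzero: "\<alpha> \<noteq> 0" "\<beta> \<noteq> 0" "\<gamma> \<noteq> 0" "w1 \<noteq> 0" "w2 \<noteq> 0" using pos wp by auto
  have lnw: "ln w1 = e - ln \<alpha>" "ln w2 = - e - ln \<beta>" by (simp_all add: w1_def w2_def)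
  note A = incomplete_pcm_bowtie[OF pos]
  have wpos: "positive_vec 5 w"
    unfolding positive_vec_def all_less_5 using wp w carrier_vecI[OF w(6)] by simp
  have residual: "\<forall>i<5. (\<Sum>j | j < 5 \<and> ?A $$ (i, j) \<noteq> None.
      ln (the (?A $$ (i, j))) - ln (w $ i / w $ j)) = 0"
  proof -
    \<comment> \<open>Padding with 0 gives a sum over a fixed index set that simplification can
      expand.\<close>
    have known: "(\<Sum>j | j < 5 \<and> ?A $$ (i, j) \<noteq> None. ln (the (?A $$ (i, j))) - ln (w $ i / w $ j)) =
        (\<Sum>j<5. if ?A $$ (i, j) \<noteq> None then ln (the (?A $$ (i, j))) - ln (w $ i / w $ j) else 0)"
      for i
      by (rule sum.mono_neutral_cong_left) auto
    have "3 * e = ln \<alpha> + ln \<gamma> - ln \<beta>" by (simp add: e_def)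
    then show ?thesis
      unfolding all_less_5 known lessThan_5
      by (simp add: bowtie_pcm_def w ln_div nonzero lnw)
  qed
  have iff: "lls_optimal_completion ?A B \<longleftrightarrow>
      B = mat 5 5 (\<lambda>(i, j). case ?A $$ (i, j) of Some a \<Rightarrow> a | None \<Rightarrow> w $ i / w $ j)" for B
    using lls_optimal_completion_iff[OF A wpos _ bowtie_pcm_hub] residual by simp
  then show "\<exists>B. lls_optimal_completion ?A B" by blast
  assume "lls_optimal_completion ?A B"
  then have "B $$ (1, 4) = w1 / w2" using iff by (simp add: bowtie_pcm_def w)
  then have "ln (B $$ (1, 4)) = ln w1 - ln w2" by (simp add: ln_div nonzero)
  then show "ln (B $$ (1, 4)) = (2 * ln \<gamma> + ln \<beta> - ln \<alpha>) / 3"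
    by (simp add: lnw e_def field_simps)
qed

text \<open>The additive equations say that (4, 1, 1, 1, 1) is a right eigenvector for 6 once the
  missing entries are 1; the product makes (4, 13, 13, 13, 13) a left one. Both are constant off the
  hub, so the flow on missing edges vanishes.\<close>

lemma eigenvalue_optimal_completion_bowtie:
  assumes pos: "\<alpha> > 0" "\<beta> > 0" "\<gamma> > 0"
    and "\<alpha> + \<beta> = 10" "4 / \<alpha> + \<gamma> = 3" "4 / \<beta> + 1 / \<gamma> = 3"
    and "\<alpha> * \<beta> = 13"
  shows "\<exists>C. eigenvalue_optimal_completion (bowtie_pcm \<alpha> \<beta> \<gamma>) C"
    and "eigenvalue_optimal_completion (bowtie_pcm \<alpha> \<beta> \<gamma>) C \<Longrightarrow> C $$ (1, 4) = 1"
proof -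
  let ?A = "bowtie_pcm \<alpha> \<beta> \<gamma>"
  \<comment> \<open>\<open>restrict\<close> supplies \<open>undefined\<close> outside the missing
    positions, as the extensional function space requires.\<close>
  define x :: "nat \<times> nat \<Rightarrow> real" where "x = restrict (\<lambda>_. 1) (missing ?A)"
  define M where "M = complete_with ?A x"
  note A = incomplete_pcm_bowtie[OF pos]
  have x: "x \<in> missing ?A \<rightarrow>\<^sub>E {0<..}" by (simp add: x_def)
  have dim: "dim_row ?A = 5" by (simp add: bowtie_pcm_def)
  have M: "M $$ (i, j) = (case ?A $$ (i, j) of Some a \<Rightarrow> a | None \<Rightarrow> 1)" if "i < 5" "j < 5" for i j
  proof (cases "?A $$ (i, j)")
    case None
    moreover have "?A $$ (j, i) = None" by (rule incomplete_pcmD(5)[OF A that None])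
    moreover have "i \<noteq> j" using incomplete_pcmD(2)[OF A that(1)] None by auto
    ultimately show ?thesis
      using that by (simp add: M_def complete_with_def dim x_def missing_def)
  qed (use that in \<open>simp add: M_def complete_with_def dim\<close>)
  define u v :: "nat \<Rightarrow> real" where "u i = (if i = 0 then 4 else 1)"
    and "v i = (if i = 0 then 4 else 13)" for i
  \<comment> \<open>Reciprocals become linear through the product 13, and the column equations for
    \<open>v\<close> turn into the row equations for \<open>u\<close>.\<close>
  have inv: "1 / \<alpha> = \<beta> / 13" "1 / \<beta> = \<alpha> / 13"
    using pos \<open>\<alpha> * \<beta> = 13\<close> by (auto simp: field_simps)
  have \<gamma>: "13 / \<gamma> = 39 - 4 * \<alpha>" "13 * \<gamma> = 39 - 4 * \<beta>"
    using assms(5,6) arg_cong[OF inv(1), of "\<lambda>t. 4 * t"] arg_cong[OF inv(2), of "\<lambda>t. 4 * t"]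
    by simp_all
  have right: "\<forall>i<5. (\<Sum>j<5. M $$ (i, j) * u j) = 6 * u i"
    unfolding all_less_5 lessThan_5 using assms(4-6)
    by (simp add: M bowtie_pcm_def u_def)
  have left: "\<forall>j<5. (\<Sum>i<5. v i * M $$ (i, j)) = 6 * v j"
    unfolding all_less_5 lessThan_5 using assms(4-6)
    by (simp add: M bowtie_pcm_def v_def inv \<gamma>)
  have critical: "v i * M $$ (i, j) * u j = v j * M $$ (j, i) * u i"
    if "i < 5" "j < 5" "?A $$ (i, j) = None" for i j
  proof -
    have "?A $$ (j, i) = None" by (rule incomplete_pcmD(5)[OF A that])
    moreover have "i \<noteq> 0" using bowtie_pcm_hub that by metis
    moreover have "j \<noteq> 0" using bowtie_pcm_hub[OF that(1)] \<open>?A $$ (j, i) = None\<close> by metis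
    ultimately show ?thesis using that M by (simp add: u_def v_def)
  qed
  have iff: "eigenvalue_optimal_completion ?A C \<longleftrightarrow> C = M" for C
    unfolding M_def
  proof (rule eigenvalue_optimal_completion_iff[OF A x _ bowtie_pcm_hub])
    show "u i > 0" "v i > 0" for i by (simp_all add: u_def v_def)
  qed (use right left critical in \<open>auto simp: M_def\<close>)
  then show "\<exists>C. eigenvalue_optimal_completion ?A C" by blast
  assume "eigenvalue_optimal_completion ?A C"
  then show "C $$ (1, 4) = 1" using iff M by (simp add: bowtie_pcm_def)
qed

text \<open>The two existence clauses keep the final implication from being vacuous.\<close>

theorem lemma2:
  shows "\<exists>A :: real option mat.
    incomplete_pcm 5 A \<and>
    Digraph_Component.connected (with_proj (comparison_graph A)) \<and>
    (\<exists>B. lls_optimal_completion A B) \<and>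
    (\<exists>C. eigenvalue_optimal_completion A C) \<and>
    (\<forall>B C. lls_optimal_completion A B \<longrightarrow> eigenvalue_optimal_completion A C \<longrightarrow> B \<noteq> C)"
proof -
  define s :: real where "s = sqrt 3"
  \<comment> \<open>Multiplying \<open>\<gamma> = 3 - 4 / \<alpha>\<close> by
    \<open>1 / \<gamma> = 3 - 4 / \<beta>\<close> and using the sum 10 gives the product 13. So
    \<open>\<alpha>\<close> and \<open>\<beta>\<close> are the roots of
    \<open>t^2 - 10 * t + 13\<close>, and \<open>\<gamma>\<close> follows.\<close>
  define \<alpha> \<beta> \<gamma> where "\<alpha> = 5 + 2 * s" and "\<beta> = 5 - 2 * s" and "\<gamma> = (19 + 8 * s) / 13"
  have s2: "s * s = 3" and s0: "s > 0" by (simp_all add: s_def)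
  have s2': "s * (s * t) = 3 * t" for t by (simp add: s2 flip: mult.assoc)
  have s_le: "s < 2" using real_sqrt_less_iff[of 3 4] by (simp add: s_def)
  have pos: "\<alpha> > 0" "\<beta> > 0" "\<gamma> > 0" using s0 s_le by (simp_all add: \<alpha>_def \<beta>_def \<gamma>_def)
  have prod: "\<alpha> * \<beta> = 13" by (simp add: \<alpha>_def \<beta>_def algebra_simps s2)
  have "\<gamma> * (19 - 8 * s) = 13" by (simp add: \<gamma>_def algebra_simps s2)
  then have inv\<gamma>: "1 / \<gamma> = (19 - 8 * s) / 13" using pos(3) by (simp add: field_simps)
  have inv: "4 / \<alpha> = 4 * \<beta> / 13" "4 / \<beta> = 4 * \<alpha> / 13"
    using pos prod by (auto simp: field_simps)
  have "4 / \<alpha> + \<gamma> = 3" "4 / \<beta> + 1 / \<gamma> = 3"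
    unfolding inv inv\<gamma> by (simp_all add: \<alpha>_def \<beta>_def \<gamma>_def field_simps)
  note eigen = eigenvalue_optimal_completion_bowtie[OF pos _ this prod]
  have sum: "\<alpha> + \<beta> = 10" by (simp add: \<alpha>_def \<beta>_def)
  \<comment> \<open>The least squares entry at (1, 4) exceeds 1 exactly if
    \<open>\<alpha> < \<gamma> * \<gamma> * \<beta>\<close>. Over the denominator 169,
    \<open>\<alpha>\<close> is \<open>845 + 338 * s\<close>, smaller in both coefficients.\<close>
  have "\<gamma> * \<gamma> * \<beta> = (941 + 414 * s) / 169"
    by (simp add: \<beta>_def \<gamma>_def field_simps s2 s2')
  then have "\<alpha> < \<gamma> * \<gamma> * \<beta>"
    using s0 by (simp add: \<alpha>_def)
  then have "ln \<alpha> < ln (\<gamma> * \<gamma> * \<beta>)" using pos by simp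
  then have gap: "2 * ln \<gamma> + ln \<beta> - ln \<alpha> > 0" using pos by (simp add: ln_mult_pos)
  have "B \<noteq> C" if "lls_optimal_completion (bowtie_pcm \<alpha> \<beta> \<gamma>) B"
    "eigenvalue_optimal_completion (bowtie_pcm \<alpha> \<beta> \<gamma>) C" for B C
    using lls_optimal_completion_bowtie(2)[OF pos that(1)] eigen(2)[OF sum that(2)] gap by auto
  then show ?thesis
    using incomplete_pcm_bowtie[OF pos] lls_optimal_completion_bowtie(1)[OF pos] eigen(1)[OF sum]
      connected_comparison_graph[OF incomplete_pcm_bowtie[OF pos], of 0] bowtie_pcm_hub
    by (intro exI[of _ "bowtie_pcm \<alpha> \<beta> \<gamma>"]) auto
qed

end
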